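(* Consider the pulled-back EFIE operators $\widetilde{\mathcal T}_\varepsilon=\widetilde{\mathcal T}_{\varepsilon,\boldsymbol y}$, the forms $\mathsf a_0,\mathsf a_{\boldsymbol y}$, and the discrete spaces $X_h,Y_h\subset X$ described in the context. Assume (G): there are $\varepsilon_0>0$ and $C_{\mathrm{geo}}>0$ such that $\|\widetilde{\mathcal T}_\varepsilon-\widetilde{\mathcal T}_0\|_{\mathcal L(X,X')}\le C_{\mathrm{geo}}\,\varepsilon$ for $0\le\varepsilon\le\varepsilon_0$, uniformly in $\boldsymbol y\in U$. Then, for all $0\le\varepsilon\le\varepsilon_0$, $$|\mathsf a_0(\boldsymbol u_h,\boldsymbol v_h)-\mathsf a_{\boldsymbol y}(\boldsymbol u_h,\boldsymbol v_h)|\le C_{\mathrm{geo}}\,\varepsilon\,\|\boldsymbol u_h\|_X\|\boldsymbol v_h\|_Y\qquad\forall\,\boldsymbol u_h\in X_h,\ \boldsymbol v_h\in Y_h,$$ uniformly in $\boldsymbol y\in U$ and with a constant independent of $h$. Equivalently, with $\gamma_{\mathsf a_0,h}$ the discrete inf-sup constant of $\mathsf a_0$ at mesh level $h$, $\mathsf a_{\boldsymbol y}\in\Phi_{h,\nu_h}(\mathsf a_0)$ with $$\nu_h(\varepsilon):=\frac{C_{\mathrm{geo}}\,\varepsilon}{\gamma_{\mathsf a_0,h}},$$ which lies in $[0,1)$ for all $\varepsilon<\gamma_{\mathsf a_0,h}/C_{\mathrm{geo}}$. Moreover, assume (S): there are $h_0>0$, $\underline\gamma>0$, $\overline M<\infty$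 such that for all $0<h\le h_0$, $\min\{\gamma_{\mathsf m},\gamma_{\mathsf n},\gamma_{\mathsf c},\gamma_{\mathsf a_0}\}\ge\underline\gamma$ and $\max\{\|\mathsf m\|,\|\mathsf n\|,\|\mathsf c\|,\|\mathsf a_0\|\}\le\overline M$; put $\underline\gamma_{\mathsf a_0}:=\inf_{0<h\le h_0}\gamma_{\mathsf a_0,h}$ and $$\bar\nu(\varepsilon):=\frac{C_{\mathrm{geo}}\,\varepsilon}{\underline\gamma_{\mathsf a_0}}\ \ge\ \nu_h(\varepsilon).$$ Then $\mathsf a_{\boldsymbol y}\in\Phi_{h,\nu_h}(\mathsf a_0)\subset\Phi_{h,\bar\nu}(\mathsf a_0)$ for every $h\le h_0$, with $\bar\nu(\varepsilon)$ independent of $h$; and $\bar\nu<1$ holds simultaneously at every mesh level once $\varepsilon<\underline\gamma_{\mathsf a_0}/C_{\mathrm{geo}}$.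
   Context: **Geometry.** $D_0\subset\mathbb R^3$ is a bounded Lipschitz domain, $\Gamma_0=\partial D_0$, exterior unit normal $\boldsymbol n$. $\{\boldsymbol\psi_j\}_{j\in\mathbb N}\subset C^{1,1}(\mathbb R^3;\mathbb R^3)$ with $C_0:=\sum_j\|\boldsymbol\psi_j\|_{C^{1,1}}<\infty$; $U:=[-1,1]^{\mathbb N}$. For $\boldsymbol y\in U$, $r\ge0$: $\boldsymbol\varphi_{r}=\mathrm{Id}+r\sum_jy_j\boldsymbol\psi_j$, $\Gamma_r=\boldsymbol\varphi_r(\Gamma_0)$. All amplitudes are small enough that $\boldsymbol\varphi_r$ is, for every $\boldsymbol y\in U$, a bi-Lipschitz diffeomorphism onto its image (guaranteed if $r<1/(2C_0)$). **EFIE.** Fixed $\kappa>0$, $\kappa^2$ not an interior Maxwell eigenvalue of $D_0$; $G_\kappa(\boldsymbol x,\boldsymbol z)=e^{-\iota\kappa|\boldsymbol x-\boldsymbol z|}/(4\pi|\boldsymbol x-\boldsymbol z|)$; $$\mathcal T_\Gamma\boldsymbol j(\boldsymbol x)=-\iota\kappa\,\boldsymbol n\times\int_\Gamma G_\kappa(\boldsymbol x,\boldsymbol z)\boldsymbol j(\boldsymbol z)\,d\boldsymbol z+\frac1{\iota\kappa}\,\boldsymbol n\times\nabla_{\boldsymbol x}\int_\Gamma G_\kappa(\boldsymbol x,\boldsymbol z)\,\mathrm{div}_\Gamma\boldsymbol j(\boldsymbol z)\,d\boldsymbol z .$$ $X:=\boldsymbol H^{-1/2}(\mathrm{div}_\Gamma,\Gamma_0)$,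 $Y:=X$. Rotated pairing $\langle\boldsymbol u,\boldsymbol v\rangle_{\times,\Gamma}=\int_\Gamma(\boldsymbol u\times\boldsymbol n)\cdot\boldsymbol v$, extended by continuity; $X'$ is the dual of $X$ realised through this pairing (with the dual norm). $\mathcal P_r:\boldsymbol H^{-1/2}(\mathrm{div}_\Gamma,\Gamma_0)\to\boldsymbol H^{-1/2}(\mathrm{div}_\Gamma,\Gamma_r)$ is the contravariant surface Piola transform, $(\mathcal P_r\boldsymbol u)\circ\boldsymbol\varphi_r=J_r^{-1}(\mathrm D_\Gamma\boldsymbol\varphi_r)\boldsymbol u$, $J_r$ the surface Jacobian. $\widetilde{\mathcal T}_r\in\mathcal L(X,X')$ and $\widetilde{\mathsf a}_r$ are defined by $\langle\widetilde{\mathcal T}_r\boldsymbol u,\boldsymbol v\rangle_{\times,\Gamma_0}=\widetilde{\mathsf a}_r(\boldsymbol u,\boldsymbol v):=\langle\mathcal T_{\Gamma_r}(\mathcal P_r\boldsymbol u),\mathcal P_r\boldsymbol v\rangle_{\times,\Gamma_r}$ for $\boldsymbol u,\boldsymbol v\in X$; $\mathsf a_0:=\widetilde{\mathsf a}_0$, $\mathsf a_{\boldsymbol y}:=\widetilde{\mathsf a}_\varepsilon$. **Discretization.** For each $h>0$, $X_h,Y_h\subset X$ are finite-dimensional div-conforming boundary element spaces (of RWG/Buffa–Christiansen type) on a triangulation of $\Gamma_0$ of size $h$, serving as trial and test spaces for $\mathsf a_0$; only the inclusion in $X$ is used. There are also auxiliary discrete spaces $V_h,W_h\subset X$ and nominal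 bilinear forms $\mathsf n$ on $V_h\times Y_h$, $\mathsf m$ on $X_h\times W_h$ (duality pairings) and $\mathsf c$ on $V_h\times W_h$ (EFIE form). For a form $\mathsf b$ on a pair of discrete spaces, $\gamma_{\mathsf b}=\inf_{0\ne u}\sup_{0\ne w}|\mathsf b(u,w)|/(\|u\|\|w\|)$ is its discrete inf-sup constant and $\|\mathsf b\|$ its continuity constant; $\gamma_{\mathsf a_0}$ at level $h$ is denoted $\gamma_{\mathsf a_0,h}$ (assumed positive). **$(h,\nu)$-perturbation.** For $\nu\in[0,1)$, $h>0$, a bounded bilinear form $\mathsf a_\nu$ on $X\times Y$ is an $(h,\nu)$-perturbation of $\mathsf a$, written $\mathsf a_\nu\in\Phi_{h,\nu}(\mathsf a)$, if $\gamma_{\mathsf a}^{-1}|\mathsf a(u_h,v_h)-\mathsf a_\nu(u_h,v_h)|\le\nu\|u_h\|_X\|v_h\|_Y$ for all $u_h\in X_h$, $v_h\in Y_h$. Membership statements are understood for $\varepsilon$ such that the parameter ($\nu_h$ or $\bar\nu$) lies in $[0,1)$. *)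

theory Defs
  imports "HOL-Analysis.Analysis"
begin

section \<open>Surfaces in three-space\<close>

text \<open>Near each boundary point the domain is, after a rotation, the strict hypograph of a Lipschitz
  function; \<open>g\<close> is a function of the component orthogonal to the unit vector \<open>e\<close>.\<close>

definition bounded_lipschitz_domain :: "(real^3) set \<Rightarrow> bool" where
  "bounded_lipschitz_domain D \<longleftrightarrow>
     open D \<and> bounded D \<and> connected D \<and> D \<noteq> {} \<and>
     (\<forall>p\<in>frontier D. \<exists>e U g L. norm e = 1 \<and> open U \<and> p \<in> U \<and>
        L-lipschitz_on {z. z \<bullet> e = 0} (g :: real^3 \<Rightarrow> real) \<and>
        D \<inter> U = {x \<in> U. x \<bullet> e < g (x - (x \<bullet> e) *\<^sub>R e)})"

text \<open>The two-dimensional Hausdorff measure, normalised so that it is the surface area.\<close>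

definition hausdorff2_pre :: "real \<Rightarrow> (real^3) set \<Rightarrow> ennreal" where
  "hausdorff2_pre \<delta> A =
     Inf {(\<Sum>i. ennreal (pi / 4 * (diameter (C i))\<^sup>2)) | C :: nat \<Rightarrow> (real^3) set.
            A \<subseteq> (\<Union>i. C i) \<and> (\<forall>i. bounded (C i) \<and> diameter (C i) \<le> \<delta>)}"

definition hausdorff2 :: "(real^3) measure" where
  "hausdorff2 = measure_of UNIV (sets borel) (\<lambda>A. SUP \<delta>\<in>{0<..}. hausdorff2_pre \<delta> A)"

text \<open>All objects on a surface \<open>\<Gamma>\<close> are indexed by the domain \<open>D\<close> with \<open>\<Gamma> = frontier D\<close>.\<close>

definition surface_measure :: "(real^3) set \<Rightarrow> (real^3) measure" where
  "surface_measure D = restrict_space hausdorff2 (frontier D)"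

text \<open>\<open>n\<close> is the exterior normal at \<open>x\<close> if, to first order at \<open>x\<close>, the domain is the half-space
  \<open>(y - x) \<bullet> n < 0\<close>. For a Lipschitz domain it exists, and is then unique, at almost every
  boundary point; at the remaining points \<open>ext_normal\<close> is zero.\<close>

definition is_ext_normal :: "(real^3) set \<Rightarrow> real^3 \<Rightarrow> real^3 \<Rightarrow> bool" where
  "is_ext_normal D x n \<longleftrightarrow> norm n = 1 \<and>
     (\<forall>\<delta>>0. eventually (\<lambda>y. ((y - x) \<bullet> n < - \<delta> * norm (y - x) \<longrightarrow> y \<in> D) \<and>
                           ((y - x) \<bullet> n > \<delta> * norm (y - x) \<longrightarrow> y \<notin> D)) (at x))"

definition ext_normal :: "(real^3) set \<Rightarrow> real^3 \<Rightarrow> real^3" where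
  "ext_normal D x = (if \<exists>!n. is_ext_normal D x n then THE n. is_ext_normal D x n else 0)"


section \<open>Complex vector fields\<close>

type_synonym cfield = "real^3 \<Rightarrow> complex^3"

text \<open>Bilinear, i.e. without complex conjugation.\<close>

definition cdot :: "complex^3 \<Rightarrow> complex^3 \<Rightarrow> complex" where
  "cdot a b = (\<Sum>i\<in>UNIV. a $ i * b $ i)"

definition ccross :: "complex^3 \<Rightarrow> complex^3 \<Rightarrow> complex^3" where
  "ccross a b = vector [a$2 * b$3 - a$3 * b$2, a$3 * b$1 - a$1 * b$3, a$1 * b$2 - a$2 * b$1]"

definition cvec :: "real^3 \<Rightarrow> complex^3" where
  "cvec v = (\<chi> i. complex_of_real (v $ i))"

definition partial :: "(real^3 \<Rightarrow> complex) \<Rightarrow> 3 \<Rightarrow> real^3 \<Rightarrow> complex" where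
  "partial f i x = frechet_derivative f (at x) (axis i 1)"

definition cgrad :: "(real^3 \<Rightarrow> complex) \<Rightarrow> cfield" where
  "cgrad f x = (\<chi> i. partial f i x)"

definition ccurl :: "cfield \<Rightarrow> cfield" where
  "ccurl F x = vector
     [partial (\<lambda>z. F z $ 3) 2 x - partial (\<lambda>z. F z $ 2) 3 x,
      partial (\<lambda>z. F z $ 1) 3 x - partial (\<lambda>z. F z $ 3) 1 x,
      partial (\<lambda>z. F z $ 2) 1 x - partial (\<lambda>z. F z $ 1) 2 x]"

definition C1_map :: "(real^3 \<Rightarrow> 'b::real_normed_vector) \<Rightarrow> bool" where
  "C1_map f \<longleftrightarrow> (\<forall>x. f differentiable (at x)) \<and>
     (\<forall>v. continuous_on UNIV (\<lambda>x. frechet_derivative f (at x) v))"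

definition C2_fun :: "(real^3 \<Rightarrow> complex) \<Rightarrow> bool" where
  "C2_fun p \<longleftrightarrow> C1_map p \<and> C1_map (cgrad p)"

text \<open>Tangential component \<open>n \<times> (w \<times> n)\<close> of a field on the boundary.\<close>

definition tangential :: "(real^3) set \<Rightarrow> cfield \<Rightarrow> cfield" where
  "tangential D w x = ccross (cvec (ext_normal D x)) (ccross (w x) (cvec (ext_normal D x)))"

definition L2_tangential :: "(real^3) set \<Rightarrow> cfield set" where
  "L2_tangential D = {f. f \<in> borel_measurable (surface_measure D) \<and>
     integrable (surface_measure D) (\<lambda>x. (norm (f x))\<^sup>2) \<and>
     (AE x in surface_measure D. cdot (f x) (cvec (ext_normal D x)) = 0)}"


section \<open>Trace spaces\<close>

text \<open>\<open>H\<^sup>1\<^sup>/\<^sup>2\<close> on the boundary, with the Sobolev-Slobodeckij norm, for scalar functions and for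
  vector fields.\<close>

definition H12 :: "(real^3) set \<Rightarrow> (real^3 \<Rightarrow> 'a::euclidean_space) set" where
  "H12 D = {f. f \<in> borel_measurable (surface_measure D) \<and>
     integrable (surface_measure D) (\<lambda>x. (norm (f x))\<^sup>2) \<and>
     integrable (surface_measure D \<Otimes>\<^sub>M surface_measure D)
       (\<lambda>(x, y). (norm (f x - f y))\<^sup>2 / norm (x - y) ^ 3)}"

definition H12_norm :: "(real^3) set \<Rightarrow> (real^3 \<Rightarrow> 'a::euclidean_space) \<Rightarrow> real" where
  "H12_norm D f = sqrt ((\<integral>x. (norm (f x))\<^sup>2 \<partial>surface_measure D) +
     (\<integral>(x, y). (norm (f x - f y))\<^sup>2 / norm (x - y) ^ 3
        \<partial>(surface_measure D \<Otimes>\<^sub>M surface_measure D)))"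

text \<open>\<open>H\<^sup>-\<^sup>1\<^sup>/\<^sup>2\<close> as the space of bounded complex-linear functionals on \<open>H\<^sup>1\<^sup>/\<^sup>2\<close>; \<open>sc\<close> is the complex
  scalar multiplication of the target space. Functionals are zero off \<open>H12 D\<close>, so that equal
  elements are equal as functions.\<close>

definition H12_dual ::
    "(complex \<Rightarrow> 'a \<Rightarrow> 'a) \<Rightarrow> (real^3) set \<Rightarrow> ((real^3 \<Rightarrow> 'a::euclidean_space) \<Rightarrow> complex) set" where
  "H12_dual sc D = {u.
     (\<forall>f. f \<notin> H12 D \<longrightarrow> u f = 0) \<and>
     (\<forall>f\<in>H12 D. \<forall>g\<in>H12 D. u (\<lambda>x. f x + g x) = u f + u g) \<and>
     (\<forall>c. \<forall>f\<in>H12 D. u (\<lambda>x. sc c (f x)) = c * u f) \<and>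
     (\<exists>C. \<forall>f\<in>H12 D. cmod (u f) \<le> C * H12_norm D f)}"

text \<open>In this and the following suprema a quotient with denominator zero counts as zero.\<close>

definition H12_dual_norm ::
    "(real^3) set \<Rightarrow> ((real^3 \<Rightarrow> 'a::euclidean_space) \<Rightarrow> complex) \<Rightarrow> real" where
  "H12_dual_norm D u = (SUP f\<in>H12 D. cmod (u f) / H12_norm D f)"

type_synonym trace = "cfield \<Rightarrow> complex"

text \<open>The dual of the space of tangential components of \<open>H\<^sup>1\<^sup>/\<^sup>2\<close> fields (with the quotient norm),
  realised as the functionals on \<open>H\<^sup>1\<^sup>/\<^sup>2\<close> fields that depend on the tangential component only.
  The dual norm is then \<open>H12_dual_norm\<close>.\<close>

definition tangential_dual :: "(real^3) set \<Rightarrow> trace set" where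
  "tangential_dual D = {u \<in> H12_dual (*s) D.
     \<forall>f\<in>H12 D. (AE x in surface_measure D. tangential D f x = 0) \<longrightarrow> u f = 0}"

text \<open>The surface divergence is minus the adjoint of the surface gradient, which for \<open>p\<close> defined
  near the boundary is the tangential component of \<open>cgrad p\<close>.\<close>

definition is_surf_div :: "(real^3) set \<Rightarrow> trace \<Rightarrow> ((real^3 \<Rightarrow> complex) \<Rightarrow> complex) \<Rightarrow> bool" where
  "is_surf_div D u d \<longleftrightarrow> d \<in> H12_dual (*) D \<and> (\<forall>p. C2_fun p \<longrightarrow> d p = - u (cgrad p))"

definition surf_div :: "(real^3) set \<Rightarrow> trace \<Rightarrow> ((real^3 \<Rightarrow> complex) \<Rightarrow> complex)" where
  "surf_div D u = (THE d. is_surf_div D u d)"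

text \<open>The space \<open>H\<^sup>-\<^sup>1\<^sup>/\<^sup>2(div, \<Gamma>)\<close> and its graph norm.\<close>

definition Hdiv :: "(real^3) set \<Rightarrow> trace set" where
  "Hdiv D = {u \<in> tangential_dual D. \<exists>d. is_surf_div D u d}"

definition Hdiv_norm :: "(real^3) set \<Rightarrow> trace \<Rightarrow> real" where
  "Hdiv_norm D u = sqrt ((H12_dual_norm D u)\<^sup>2 + (H12_dual_norm D (surf_div D u))\<^sup>2)"

definition Hdiv_tendsto :: "(real^3) set \<Rightarrow> (nat \<Rightarrow> trace) \<Rightarrow> trace \<Rightarrow> bool" where
  "Hdiv_tendsto D U u \<longleftrightarrow> (\<lambda>k. Hdiv_norm D (\<lambda>f. U k f - u f)) \<longlonglongrightarrow> 0"

definition of_field :: "(real^3) set \<Rightarrow> cfield \<Rightarrow> trace" where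
  "of_field D f w = (if w \<in> H12 D then \<integral>x. cdot (f x) (w x) \<partial>surface_measure D else 0)"

text \<open>The square-integrable tangential fields in \<open>Hdiv D\<close>; they form a dense subspace, from which
  the rotated pairing and the Piola transform are extended by continuity.\<close>

definition regular_field :: "(real^3) set \<Rightarrow> cfield \<Rightarrow> bool" where
  "regular_field D f \<longleftrightarrow> f \<in> L2_tangential D \<and> of_field D f \<in> Hdiv D"

definition rot_pairing :: "(real^3) set \<Rightarrow> trace \<Rightarrow> trace \<Rightarrow> complex" where
  "rot_pairing D u v = (THE c. \<forall>F G.
     (\<forall>k. regular_field D (F k) \<and> regular_field D (G k)) \<and>
     Hdiv_tendsto D (\<lambda>k. of_field D (F k)) u \<and> Hdiv_tendsto D (\<lambda>k. of_field D (G k)) v \<longrightarrow>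
     (\<lambda>k. \<integral>x. cdot (ccross (F k x) (cvec (ext_normal D x))) (G k x) \<partial>surface_measure D)
        \<longlonglongrightarrow> c)"


section \<open>Electric field integral operator\<close>

definition helmholtz_kernel :: "real \<Rightarrow> real^3 \<Rightarrow> real^3 \<Rightarrow> complex" where
  "helmholtz_kernel \<kappa> x z =
     exp (- \<i> * complex_of_real (\<kappa> * norm (x - z))) / complex_of_real (4 * pi * norm (x - z))"

text \<open>The surface integrals of the kernel against a density are duality pairings, for \<open>x\<close> off the
  surface; the operator is obtained from their tangential traces.\<close>

definition vector_potential :: "real \<Rightarrow> trace \<Rightarrow> cfield" where
  "vector_potential \<kappa> j x = (\<chi> i. j (\<lambda>z. helmholtz_kernel \<kappa> x z *s axis i 1))"

definition scalar_potential :: "real \<Rightarrow> ((real^3 \<Rightarrow> complex) \<Rightarrow> complex) \<Rightarrow> real^3 \<Rightarrow> complex" where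
  "scalar_potential \<kappa> q x = q (\<lambda>z. helmholtz_kernel \<kappa> x z)"

text \<open>The trace \<open>n \<times> E\<close>, in the usual weak sense given by Green's formula
  \<open>\<integral>\<^bsub>\<Gamma>\<^esub> (n \<times> E) \<cdot> \<phi> = \<integral>\<^bsub>D\<^esub> curl E \<cdot> \<phi> - E \<cdot> curl \<phi>\<close>. The traces of the two potentials from the interior
  and from the exterior coincide.\<close>

definition tangential_trace :: "(real^3) set \<Rightarrow> cfield \<Rightarrow> trace" where
  "tangential_trace D E = (THE w. w \<in> Hdiv D \<and> (\<forall>\<phi>. C1_map \<phi> \<longrightarrow>
     w \<phi> = (LINT x:D|lebesgue. cdot (ccurl E x) (\<phi> x) - cdot (E x) (ccurl \<phi> x))))"

definition efie_operator :: "real \<Rightarrow> (real^3) set \<Rightarrow> trace \<Rightarrow> trace" where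
  "efie_operator \<kappa> D j = (\<lambda>w.
     - \<i> * complex_of_real \<kappa> * tangential_trace D (vector_potential \<kappa> j) w
     + 1 / (\<i> * complex_of_real \<kappa>)
         * tangential_trace D (cgrad (scalar_potential \<kappa> (surf_div D j))) w)"

definition L2_domain :: "(real^3) set \<Rightarrow> cfield \<Rightarrow> bool" where
  "L2_domain D E \<longleftrightarrow> set_borel_measurable lebesgue D E \<and>
     set_integrable lebesgue D (\<lambda>x. (norm (E x))\<^sup>2)"

text \<open>\<open>curl curl E = \<mu> E\<close> in \<open>D\<close> and \<open>n \<times> E = 0\<close> on the boundary have a nontrivial weak
  solution. Here \<open>K\<close> is the weak curl of \<open>E\<close>, and testing with fields that do not vanish near the
  boundary encodes the boundary condition.\<close>

definition interior_maxwell_eigenvalue :: "(real^3) set \<Rightarrow> real \<Rightarrow> bool" where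
  "interior_maxwell_eigenvalue D \<mu> \<longleftrightarrow> (\<exists>E K. L2_domain D E \<and> L2_domain D K \<and>
     \<not> (AE x in lebesgue. x \<in> D \<longrightarrow> E x = 0) \<and>
     (\<forall>\<phi>. C1_map \<phi> \<longrightarrow>
        (LINT x:D|lebesgue. cdot (E x) (ccurl \<phi> x)) = (LINT x:D|lebesgue. cdot (K x) (\<phi> x))) \<and>
     (\<forall>\<phi>. C1_map \<phi> \<and> compact (closure {x. \<phi> x \<noteq> 0}) \<and> closure {x. \<phi> x \<noteq> 0} \<subseteq> D \<longrightarrow>
        (LINT x:D|lebesgue. cdot (K x) (ccurl \<phi> x))
          = complex_of_real \<mu> * (LINT x:D|lebesgue. cdot (E x) (\<phi> x))))"


section \<open>Random domain deformations\<close>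

definition C11 :: "(real^3 \<Rightarrow> real^3) \<Rightarrow> bool" where
  "C11 f \<longleftrightarrow> bounded (range f) \<and> (\<forall>x. f differentiable (at x)) \<and>
     bounded (range (\<lambda>x. onorm (frechet_derivative f (at x)))) \<and>
     (\<exists>L. \<forall>x y. onorm (\<lambda>v. frechet_derivative f (at x) v - frechet_derivative f (at y) v)
                  \<le> L * dist x y)"

definition C11_norm :: "(real^3 \<Rightarrow> real^3) \<Rightarrow> real" where
  "C11_norm f = (SUP x. norm (f x)) + (SUP x. onorm (frechet_derivative f (at x))) +
     (SUP (x, y). onorm (\<lambda>v. frechet_derivative f (at x) v - frechet_derivative f (at y) v)
                    / dist x y)"

definition parameter_set :: "(nat \<Rightarrow> real) set" where
  "parameter_set = {y. \<forall>j. y j \<in> {-1..1}}"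

definition deformation :: "(nat \<Rightarrow> real^3 \<Rightarrow> real^3) \<Rightarrow> (nat \<Rightarrow> real) \<Rightarrow> real \<Rightarrow> real^3 \<Rightarrow> real^3" where
  "deformation \<psi> y r x = x + r *\<^sub>R (\<Sum>j. y j *\<^sub>R \<psi> j x)"

definition bilipschitz_diffeo :: "(real^3 \<Rightarrow> real^3) \<Rightarrow> bool" where
  "bilipschitz_diffeo \<phi> \<longleftrightarrow>
     (\<exists>c>0. \<exists>L. \<forall>x y. c * dist x y \<le> dist (\<phi> x) (\<phi> y) \<and> dist (\<phi> x) (\<phi> y) \<le> L * dist x y) \<and>
     (\<forall>x. \<phi> differentiable (at x)) \<and>
     (\<forall>z\<in>range \<phi>. inv \<phi> differentiable (at z within range \<phi>))"

definition surface_jacobian :: "(real^3) set \<Rightarrow> (real^3 \<Rightarrow> real^3) \<Rightarrow> real^3 \<Rightarrow> real" where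
  "surface_jacobian D \<phi> x = (THE J. \<forall>s t. norm s = 1 \<and> norm t = 1 \<and> s \<bullet> t = 0 \<and>
     s \<bullet> ext_normal D x = 0 \<and> t \<bullet> ext_normal D x = 0 \<longrightarrow>
     J = norm (cross3 (frechet_derivative \<phi> (at x) s) (frechet_derivative \<phi> (at x) t)))"

text \<open>Complex-linear extension of a real-linear map.\<close>

definition complexify :: "(real^3 \<Rightarrow> real^3) \<Rightarrow> complex^3 \<Rightarrow> complex^3" where
  "complexify A w = (\<chi> i. Complex (A (\<chi> k. Re (w $ k)) $ i) (A (\<chi> k. Im (w $ k)) $ i))"

text \<open>On tangential fields the full derivative of \<open>\<phi>\<close> acts as its surface derivative.\<close>

definition piola_field :: "(real^3) set \<Rightarrow> (real^3 \<Rightarrow> real^3) \<Rightarrow> cfield \<Rightarrow> cfield" where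
  "piola_field D \<phi> f z = (let x = inv \<phi> z in
     complex_of_real (1 / surface_jacobian D \<phi> x) *s complexify (frechet_derivative \<phi> (at x)) (f x))"

definition piola :: "(real^3) set \<Rightarrow> (real^3 \<Rightarrow> real^3) \<Rightarrow> trace \<Rightarrow> trace" where
  "piola D \<phi> u = (THE w. w \<in> Hdiv (\<phi> ` D) \<and> (\<forall>F.
     (\<forall>k. regular_field D (F k)) \<and> Hdiv_tendsto D (\<lambda>k. of_field D (F k)) u \<longrightarrow>
     Hdiv_tendsto (\<phi> ` D) (\<lambda>k. of_field (\<phi> ` D) (piola_field D \<phi> (F k))) w))"

text \<open>The boundary of \<open>\<phi> ` D\<close> is the image of the boundary of \<open>D\<close>.\<close>

definition pulled_form ::
    "real \<Rightarrow> (real^3) set \<Rightarrow> (real^3 \<Rightarrow> real^3) \<Rightarrow> trace \<Rightarrow> trace \<Rightarrow> complex" where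
  "pulled_form \<kappa> D \<phi> u v =
     rot_pairing (\<phi> ` D) (efie_operator \<kappa> (\<phi> ` D) (piola D \<phi> u)) (piola D \<phi> v)"

text \<open>An element of the dual space realised through the rotated pairing is represented by the
  functional that it induces, here \<open>v \<mapsto> pulled_form \<kappa> D \<phi> u v\<close>.\<close>

definition pulled_operator ::
    "real \<Rightarrow> (real^3) set \<Rightarrow> (real^3 \<Rightarrow> real^3) \<Rightarrow> trace \<Rightarrow> (trace \<Rightarrow> complex)" where
  "pulled_operator \<kappa> D \<phi> u = (\<lambda>v. pulled_form \<kappa> D \<phi> u v)"


section \<open>Operators into the dual, bilinear forms and perturbation classes\<close>

definition dual_space :: "trace set \<Rightarrow> (trace \<Rightarrow> real) \<Rightarrow> (trace \<Rightarrow> complex) set" where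
  "dual_space X N = {l.
     (\<forall>u\<in>X. \<forall>v\<in>X. l (\<lambda>f. u f + v f) = l u + l v) \<and>
     (\<forall>c. \<forall>u\<in>X. l (\<lambda>f. c * u f) = c * l u) \<and>
     (\<exists>C. \<forall>u\<in>X. cmod (l u) \<le> C * N u)}"

definition dual_norm :: "trace set \<Rightarrow> (trace \<Rightarrow> real) \<Rightarrow> (trace \<Rightarrow> complex) \<Rightarrow> real" where
  "dual_norm X N l = (SUP v\<in>X. cmod (l v) / N v)"

definition bounded_operators ::
    "trace set \<Rightarrow> (trace \<Rightarrow> real) \<Rightarrow> (trace \<Rightarrow> trace \<Rightarrow> complex) set" where
  "bounded_operators X N = {A.
     (\<forall>u\<in>X. A u \<in> dual_space X N) \<and>
     (\<forall>u\<in>X. \<forall>v\<in>X. \<forall>w\<in>X. A (\<lambda>f. u f + v f) w = A u w + A v w) \<and>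
     (\<forall>c. \<forall>u\<in>X. \<forall>w\<in>X. A (\<lambda>f. c * u f) w = c * A u w) \<and>
     (\<exists>C. \<forall>u\<in>X. dual_norm X N (A u) \<le> C * N u)}"

definition operator_norm ::
    "trace set \<Rightarrow> (trace \<Rightarrow> real) \<Rightarrow> (trace \<Rightarrow> trace \<Rightarrow> complex) \<Rightarrow> real" where
  "operator_norm X N A = (SUP u\<in>X. dual_norm X N (A u) / N u)"

definition bilinear_form_on :: "trace set \<Rightarrow> trace set \<Rightarrow> (trace \<Rightarrow> trace \<Rightarrow> complex) \<Rightarrow> bool" where
  "bilinear_form_on S T b \<longleftrightarrow>
     (\<forall>u\<in>S. \<forall>v\<in>S. \<forall>w\<in>T. b (\<lambda>f. u f + v f) w = b u w + b v w) \<and>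
     (\<forall>c. \<forall>u\<in>S. \<forall>w\<in>T. b (\<lambda>f. c * u f) w = c * b u w) \<and>
     (\<forall>u\<in>S. \<forall>v\<in>T. \<forall>w\<in>T. b u (\<lambda>f. v f + w f) = b u v + b u w) \<and>
     (\<forall>c. \<forall>u\<in>S. \<forall>w\<in>T. b u (\<lambda>f. c * w f) = c * b u w)"

definition bounded_form_on ::
    "(trace \<Rightarrow> real) \<Rightarrow> trace set \<Rightarrow> trace set \<Rightarrow> (trace \<Rightarrow> trace \<Rightarrow> complex) \<Rightarrow> bool" where
  "bounded_form_on N S T b \<longleftrightarrow> (\<exists>C. \<forall>u\<in>S. \<forall>w\<in>T. cmod (b u w) \<le> C * N u * N w)"

definition finite_dim_subspace :: "trace set \<Rightarrow> trace set \<Rightarrow> bool" where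
  "finite_dim_subspace X S \<longleftrightarrow> S \<subseteq> X \<and>
     (\<exists>B. finite B \<and> S = {\<lambda>f. \<Sum>b\<in>B. c b * b f | c :: trace \<Rightarrow> complex. True})"

definition infsup ::
    "(trace \<Rightarrow> real) \<Rightarrow> trace set \<Rightarrow> trace set \<Rightarrow> (trace \<Rightarrow> trace \<Rightarrow> complex) \<Rightarrow> real" where
  "infsup N S T b =
     (INF u\<in>S - {\<lambda>_. 0}. SUP w\<in>T - {\<lambda>_. 0}. cmod (b u w) / (N u * N w))"

definition form_norm ::
    "(trace \<Rightarrow> real) \<Rightarrow> trace set \<Rightarrow> trace set \<Rightarrow> (trace \<Rightarrow> trace \<Rightarrow> complex) \<Rightarrow> real" where
  "form_norm N S T b =
     (SUP (u, w)\<in>(S - {\<lambda>_. 0}) \<times> (T - {\<lambda>_. 0}). cmod (b u w) / (N u * N w))"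

text \<open>The \<open>(h, \<nu>)\<close>-perturbations of \<open>a\<close>, where \<open>S\<close> and \<open>T\<close> are the trial and test spaces at
  level \<open>h\<close> and trial and test functions belong to the same space \<open>X\<close>.\<close>

definition perturbations ::
    "trace set \<Rightarrow> (trace \<Rightarrow> real) \<Rightarrow> trace set \<Rightarrow> trace set \<Rightarrow> real \<Rightarrow>
     (trace \<Rightarrow> trace \<Rightarrow> complex) \<Rightarrow> (trace \<Rightarrow> trace \<Rightarrow> complex) set" where
  "perturbations X N S T \<nu> a = {a'. \<nu> \<in> {0..<1} \<and>
     bilinear_form_on X X a' \<and> bounded_form_on N X X a' \<and>
     (\<forall>u\<in>S. \<forall>v\<in>T. inverse (infsup N S T a) * cmod (a u v - a' u v) \<le> \<nu> * N u * N v)}"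

end

theory Submission
  imports Defs
begin

text \<open>The form \<open>a \<epsilon> y\<close> and the operator \<open>T \<epsilon> y\<close>
  are the same function of two arguments, and at amplitude zero the deformation is the identity, so
  \<open>a0 = T 0 y\<close> for every \<open>y\<close>. The error of the forms is therefore the
  pairing of \<open>T \<epsilon> y - T 0 y\<close> with its arguments, at most the operator norm
  times the norms of the arguments (\<open>bounded_operators_apply_le\<close>), and (G) bounds that
  norm by \<open>Cgeo * \<epsilon>\<close>. The estimate holds on all of \<open>X\<close>; since the
  discrete spaces are subsets of \<open>X\<close>, the constant does not see the mesh. Dividing by
  the positive inf-sup constant gives the perturbation class (\<open>perturbationsI\<close>). Under
  (S) the infimum of the inf-sup constants is positive and lies below each of them, so it gives a
  larger parameter common to all levels, and the classes grow with the parameter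
  (\<open>perturbations_mono\<close>). The care needed lies in the suprema: one dominates its
  quotients only if they are bounded above, and a quotient by zero is zero. \<open>N\<close> is used
  only as a nonnegative function.\<close>

lemma Hdiv_norm_nonneg: "Hdiv_norm D u \<ge> 0"
  by (simp add: Hdiv_norm_def)

lemma deformation_zero_amplitude: "deformation \<psi> y 0 = (\<lambda>x. x)"
  by (simp add: deformation_def fun_eq_iff)

text \<open>The constant in \<open>dual_space\<close> makes the quotients bounded above, so their
  supremum dominates each of them. Where \<open>N v = 0\<close> the quotient carries no information,
  but the same constant forces \<open>l v = 0\<close>.\<close>

lemma dual_space_apply_le:
  assumes N: "\<And>u. N u \<ge> 0" and l: "l \<in> dual_space X N" and v: "v \<in> X"
  shows "cmod (l v) \<le> dual_norm X N l * N v"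
proof -
  obtain C where C: "cmod (l u) \<le> C * N u" if "u \<in> X" for u
    using l unfolding dual_space_def by blast
  show ?thesis
  proof (cases "N v = 0")
    case True
    with C[OF v] show ?thesis by simp
  next
    case False
    with N[of v] have pos: "N v > 0" by simp
    \<comment> \<open>Quotients with zero denominator equal 0, and \<open>C\<close> may be
      negative.\<close>
    have "cmod (l u) / N u \<le> max C 0" if "u \<in> X" for u
    proof (cases "N u = 0")
      case False
      with N[of u] have "N u > 0" by simp
      with C[OF that] have "cmod (l u) / N u \<le> C" by (simp add: divide_le_eq)
      then show ?thesis by simp
    qed simp
    then have "bdd_above ((\<lambda>u. cmod (l u) / N u) ` X)" by (auto intro!: bdd_aboveI2)
    then have "cmod (l v) / N v \<le> dual_norm X N l"
      unfolding dual_norm_def using v by (intro cSUP_upper)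
    with pos show ?thesis by (simp add: divide_le_eq)
  qed
qed

lemma dual_norm_le:
  assumes N: "\<And>u. N u \<ge> 0" and "X \<noteq> {}" and "C \<ge> 0"
    and C: "\<And>v. v \<in> X \<Longrightarrow> cmod (l v) \<le> C * N v"
  shows "dual_norm X N l \<le> C"
  unfolding dual_norm_def
proof (rule cSUP_least[OF \<open>X \<noteq> {}\<close>])
  fix v assume "v \<in> X"
  show "cmod (l v) / N v \<le> C"
    using C[OF \<open>v \<in> X\<close>] N[of v] \<open>C \<ge> 0\<close>
    by (cases "N v = 0") (simp_all add: divide_le_eq less_le)
qed

text \<open>Each functional \<open>A u\<close> comes with its own constant; passing through its dual
  norm, which grows at most linearly in \<open>N u\<close>, yields one constant for both arguments.
  In this form bounds can be added.\<close>

lemma bounded_operators_bound: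
  assumes N: "\<And>u. N u \<ge> 0" and A: "A \<in> bounded_operators X N"
  obtains C where "C \<ge> 0" "\<And>u v. u \<in> X \<Longrightarrow> v \<in> X \<Longrightarrow> cmod (A u v) \<le> C * N u * N v"
proof -
  obtain C where C: "dual_norm X N (A u) \<le> C * N u" if "u \<in> X" for u
    using A unfolding bounded_operators_def by blast
  show thesis
  proof (rule that[of "max C 0"])
    fix u v assume u: "u \<in> X" and v: "v \<in> X"
    have "A u \<in> dual_space X N" using A u by (auto simp: bounded_operators_def)
    then have "cmod (A u v) \<le> dual_norm X N (A u) * N v"
      using N v by (intro dual_space_apply_le)
    also have "\<dots> \<le> max C 0 * N u * N v"
      using C[OF u] N[of u] N[of v] mult_right_mono[of C "max C 0" "N u"]
      by (intro mult_right_mono) auto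
    finally show "cmod (A u v) \<le> max C 0 * N u * N v" .
  qed simp
qed

text \<open>(G) speaks of the norm of a difference. That norm controls the values of the difference
  once the difference is itself known to be a bounded operator, so that the suprema are over bounded
  sets.\<close>

lemma bounded_operators_diff:
  assumes N: "\<And>u. N u \<ge> 0"
    and A: "A \<in> bounded_operators X N" and B: "B \<in> bounded_operators X N"
  shows "(\<lambda>u v. A u v - B u v) \<in> bounded_operators X N"
proof -
  obtain C where C: "C \<ge> 0" "\<And>u v. u \<in> X \<Longrightarrow> v \<in> X \<Longrightarrow> cmod (A u v) \<le> C * N u * N v"
    using bounded_operators_bound[OF N A] by metis
  obtain C' where C': "C' \<ge> 0" "\<And>u v. u \<in> X \<Longrightarrow> v \<in> X \<Longrightarrow> cmod (B u v) \<le> C' * N u * N v"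
    using bounded_operators_bound[OF N B] by metis
  have bound: "cmod (A u v - B u v) \<le> (C + C') * N u * N v" if "u \<in> X" "v \<in> X" for u v
    using norm_triangle_ineq4[of "A u v" "B u v"] C(2)[OF that] C'(2)[OF that]
    by (simp add: distrib_right)
  have "dual_norm X N (\<lambda>v. A u v - B u v) \<le> (C + C') * N u" if "u \<in> X" for u
    using that N C(1) C'(1) bound by (intro dual_norm_le) auto
  then have "\<exists>K. \<forall>u\<in>X. dual_norm X N (\<lambda>v. A u v - B u v) \<le> K * N u" by blast
  moreover have "(\<lambda>v. A u v - B u v) \<in> dual_space X N" if u: "u \<in> X" for u
  proof -
    have "\<exists>K. \<forall>v\<in>X. cmod (A u v - B u v) \<le> K * N v" using bound u by blast
    moreover have "A u \<in> dual_space X N" "B u \<in> dual_space X N"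
      using A B u by (auto simp: bounded_operators_def)
    ultimately show ?thesis by (auto simp: dual_space_def algebra_simps)
  qed
  ultimately show ?thesis
    using A B by (auto simp: bounded_operators_def algebra_simps)
qed

lemma bounded_operators_apply_le:
  assumes N: "\<And>u. N u \<ge> 0" and A: "A \<in> bounded_operators X N"
    and u: "u \<in> X" and v: "v \<in> X"
  shows "cmod (A u v) \<le> operator_norm X N A * N u * N v"
proof -
  obtain C where C: "C \<ge> 0" "\<And>u v. u \<in> X \<Longrightarrow> v \<in> X \<Longrightarrow> cmod (A u v) \<le> C * N u * N v"
    using bounded_operators_bound[OF N A] by metis
  show ?thesis
  proof (cases "N u = 0")
    case True
    with C(2)[OF u v] show ?thesis by simp
  next
    case False
    with N[of u] have pos: "N u > 0" by simp
    \<comment> \<open>This makes the outer supremum, the one in \<open>operator_norm\<close>, an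
      upper bound of its quotients.\<close>
    have "dual_norm X N (A w) / N w \<le> C" if "w \<in> X" for w
    proof (cases "N w = 0")
      case False
      with N[of w] have "N w > 0" by simp
      moreover have "dual_norm X N (A w) \<le> C * N w"
        using that N C by (intro dual_norm_le) auto
      ultimately show ?thesis by (simp add: divide_le_eq)
    qed (simp add: C(1))
    then have "bdd_above ((\<lambda>w. dual_norm X N (A w) / N w) ` X)" by (auto intro!: bdd_aboveI2)
    then have "dual_norm X N (A u) / N u \<le> operator_norm X N A"
      unfolding operator_norm_def using u by (intro cSUP_upper)
    with pos have le: "dual_norm X N (A u) \<le> operator_norm X N A * N u"
      by (simp add: divide_le_eq)
    have "A u \<in> dual_space X N" using A u by (auto simp: bounded_operators_def)
    then have "cmod (A u v) \<le> dual_norm X N (A u) * N v"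
      using N v by (intro dual_space_apply_le)
    also have "\<dots> \<le> operator_norm X N A * N u * N v"
      using le N by (intro mult_right_mono)
    finally show ?thesis .
  qed
qed

text \<open>Linearity in the first argument is that of the operator, in the second that of the
  functionals \<open>A u\<close>. A perturbation must be a bounded bilinear form on all of
  \<open>X\<close>, not only on the discrete spaces.\<close>

lemma bounded_operators_bounded_bilinear:
  assumes N: "\<And>u. N u \<ge> 0" and A: "A \<in> bounded_operators X N"
  shows "bilinear_form_on X X A" "bounded_form_on N X X A"
proof -
  show "bilinear_form_on X X A"
    using A by (auto simp: bilinear_form_on_def bounded_operators_def dual_space_def)
  show "bounded_form_on N X X A"
    using bounded_operators_bound[OF N A] unfolding bounded_form_on_def by metis
qed

lemma perturbationsI:
  assumes "bilinear_form_on X X a'" "bounded_form_on N X X a'"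
    and pos: "infsup N S T a > 0" and "C / infsup N S T a \<in> {0..<1}"
    and le: "\<And>u v. u \<in> S \<Longrightarrow> v \<in> T \<Longrightarrow> cmod (a u v - a' u v) \<le> C * N u * N v"
  shows "a' \<in> perturbations X N S T (C / infsup N S T a) a"
proof -
  have "inverse (infsup N S T a) * cmod (a u v - a' u v) \<le> C / infsup N S T a * N u * N v"
    if "u \<in> S" "v \<in> T" for u v
    using mult_left_mono[OF le[OF that], of "inverse (infsup N S T a)"] pos
    by (simp add: field_simps)
  with assms show ?thesis by (simp add: perturbations_def)
qed

text \<open>Only \<open>\<nu>' < 1\<close> has to be assumed: a member of the smaller class already
  certifies \<open>0 \<le> \<nu>\<close>, hence \<open>0 \<le> \<nu>'\<close>.\<close>

lemma perturbations_mono: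
  assumes N: "\<And>u. N u \<ge> 0" and "\<nu> \<le> \<nu>'" "\<nu>' < 1"
  shows "perturbations X N S T \<nu> a \<subseteq> perturbations X N S T \<nu>' a"
proof -
  have "t \<le> \<nu>' * N u * N v" if "t \<le> \<nu> * N u * N v" for t u v
    using that N \<open>\<nu> \<le> \<nu>'\<close> by (elim order_trans) (intro mult_right_mono; simp)
  with assms show ?thesis unfolding perturbations_def by auto
qed

theorem corollary7:
  fixes D0 :: "(real^3) set"
    and \<psi> :: "nat \<Rightarrow> real^3 \<Rightarrow> real^3"
    and \<kappa> \<epsilon>0 Cgeo :: real
    and Xh Yh Vh Wh :: "real \<Rightarrow> trace set"
    and nform mform cform :: "real \<Rightarrow> trace \<Rightarrow> trace \<Rightarrow> complex"
  defines "X \<equiv> Hdiv D0"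
    and "N \<equiv> Hdiv_norm D0"
    and "T \<equiv> (\<lambda>\<epsilon> y. pulled_operator \<kappa> D0 (deformation \<psi> y \<epsilon>))"
    and "a \<equiv> (\<lambda>\<epsilon> y. pulled_form \<kappa> D0 (deformation \<psi> y \<epsilon>))"
    and "a0 \<equiv> pulled_form \<kappa> D0 (deformation \<psi> (\<lambda>_. 0) 0)"
    and "\<gamma> \<equiv> (\<lambda>h. infsup (Hdiv_norm D0) (Xh h) (Yh h)
                        (pulled_form \<kappa> D0 (deformation \<psi> (\<lambda>_. 0) 0)))"
  assumes domain: "bounded_lipschitz_domain D0"
    and fields: "\<And>j. C11 (\<psi> j)" "summable (\<lambda>j. C11_norm (\<psi> j))"
    and wavenumber: "\<kappa> > 0" "\<not> interior_maxwell_eigenvalue D0 (\<kappa>\<^sup>2)"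
    and amplitude: "\<And>r y. 0 \<le> r \<Longrightarrow> r \<le> \<epsilon>0 \<Longrightarrow> y \<in> parameter_set \<Longrightarrow>
                      bilipschitz_diffeo (deformation \<psi> y r)"
    and operators: "\<And>r y. 0 \<le> r \<Longrightarrow> r \<le> \<epsilon>0 \<Longrightarrow> y \<in> parameter_set \<Longrightarrow>
                      T r y \<in> bounded_operators X N"
    and discrete: "\<And>h. h > 0 \<Longrightarrow> finite_dim_subspace X (Xh h) \<and> finite_dim_subspace X (Yh h) \<and>
                      finite_dim_subspace X (Vh h) \<and> finite_dim_subspace X (Wh h)"
    and forms: "\<And>h. h > 0 \<Longrightarrow> bilinear_form_on (Vh h) (Yh h) (nform h) \<and>
                      bilinear_form_on (Xh h) (Wh h) (mform h) \<and>
                      bilinear_form_on (Vh h) (Wh h) (cform h)"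
    and infsup_pos: "\<And>h. h > 0 \<Longrightarrow> \<gamma> h > 0"
    and G: "\<epsilon>0 > 0" "Cgeo > 0"
           "\<And>\<epsilon> y. 0 \<le> \<epsilon> \<Longrightarrow> \<epsilon> \<le> \<epsilon>0 \<Longrightarrow> y \<in> parameter_set \<Longrightarrow>
              operator_norm X N (\<lambda>u v. T \<epsilon> y u v - T 0 y u v) \<le> Cgeo * \<epsilon>"
  shows "(\<forall>\<epsilon> y h. 0 \<le> \<epsilon> \<and> \<epsilon> \<le> \<epsilon>0 \<and> y \<in> parameter_set \<and> h > 0 \<longrightarrow>
            (\<forall>u\<in>Xh h. \<forall>v\<in>Yh h. cmod (a0 u v - a \<epsilon> y u v) \<le> Cgeo * \<epsilon> * N u * N v) \<and>
            (Cgeo * \<epsilon> / \<gamma> h \<in> {0..<1} \<longrightarrow>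
               a \<epsilon> y \<in> perturbations X N (Xh h) (Yh h) (Cgeo * \<epsilon> / \<gamma> h) a0) \<and>
            (\<epsilon> < \<gamma> h / Cgeo \<longrightarrow> Cgeo * \<epsilon> / \<gamma> h \<in> {0..<1}))
       \<and> (\<forall>h0 \<gamma>low M. h0 > 0 \<and> \<gamma>low > 0 \<and>
            (\<forall>h. 0 < h \<and> h \<le> h0 \<longrightarrow>
               Min {infsup N (Xh h) (Wh h) (mform h), infsup N (Vh h) (Yh h) (nform h),
                    infsup N (Vh h) (Wh h) (cform h), \<gamma> h} \<ge> \<gamma>low \<and>
               Max {form_norm N (Xh h) (Wh h) (mform h), form_norm N (Vh h) (Yh h) (nform h),
                    form_norm N (Vh h) (Wh h) (cform h), form_norm N (Xh h) (Yh h) a0} \<le> M) \<longrightarrow>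
            (let \<gamma>inf = (INF h\<in>{0<..h0}. \<gamma> h);
                 \<nu>bar = (\<lambda>\<epsilon>. Cgeo * \<epsilon> / \<gamma>inf)
             in \<forall>\<epsilon> y. 0 \<le> \<epsilon> \<and> \<epsilon> \<le> \<epsilon>0 \<and> y \<in> parameter_set \<longrightarrow>
               (\<forall>h. 0 < h \<and> h \<le> h0 \<longrightarrow>
                  \<nu>bar \<epsilon> \<ge> Cgeo * \<epsilon> / \<gamma> h \<and>
                  (\<nu>bar \<epsilon> \<in> {0..<1} \<longrightarrow>
                     a \<epsilon> y \<in> perturbations X N (Xh h) (Yh h) (Cgeo * \<epsilon> / \<gamma> h) a0 \<and>
                     perturbations X N (Xh h) (Yh h) (Cgeo * \<epsilon> / \<gamma> h) a0
                       \<subseteq> perturbations X N (Xh h) (Yh h) (\<nu>bar \<epsilon>) a0)) \<and>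
               (\<epsilon> < \<gamma>inf / Cgeo \<longrightarrow> \<nu>bar \<epsilon> \<in> {0..<1})))"
proof -
  have N: "N u \<ge> 0" for u by (simp add: N_def Hdiv_norm_nonneg)
  have a_T: "a \<epsilon> y = T \<epsilon> y" for \<epsilon> y
    by (simp add: a_def T_def pulled_operator_def fun_eq_iff)
  \<comment> \<open>\<open>a0\<close> is defined with the zero parameter, whereas (G) compares with
    \<open>T 0 y\<close> at the current \<open>y\<close>; amplitude zero removes the dependence on
    \<open>y\<close>.\<close>
  have a0_T: "a0 = T 0 y" for y
    by (simp add: a0_def T_def pulled_operator_def deformation_zero_amplitude fun_eq_iff)
  have \<gamma>: "\<gamma> h = infsup N (Xh h) (Yh h) a0" for h
    by (simp add: \<gamma>_def N_def a0_def)
  have diff_le: "cmod (a0 u v - a \<epsilon> y u v) \<le> Cgeo * \<epsilon> * N u * N v"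
    if \<epsilon>: "0 \<le> \<epsilon>" "\<epsilon> \<le> \<epsilon>0" "y \<in> parameter_set" and "h > 0" "u \<in> Xh h" "v \<in> Yh h" for \<epsilon> y h u v
  proof -
    have u: "u \<in> X" and v: "v \<in> X"
      using discrete[OF \<open>h > 0\<close>] that by (auto simp: finite_dim_subspace_def)
    have "T \<epsilon> y \<in> bounded_operators X N" "T 0 y \<in> bounded_operators X N"
      using \<epsilon> \<open>\<epsilon>0 > 0\<close> by (auto intro: operators)
    then have "cmod (T \<epsilon> y u v - T 0 y u v)
        \<le> operator_norm X N (\<lambda>u v. T \<epsilon> y u v - T 0 y u v) * N u * N v"
      using bounded_operators_apply_le[where N = N, OF N bounded_operators_diff[where N = N, OF N] u v]
      by blast
    also have "\<dots> \<le> Cgeo * \<epsilon> * N u * N v"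
      using G(3)[OF \<epsilon>] N by (intro mult_right_mono)
    finally show ?thesis by (simp add: a_T a0_T[of y] norm_minus_commute)
  qed
  have pert: "a \<epsilon> y \<in> perturbations X N (Xh h) (Yh h) (Cgeo * \<epsilon> / \<gamma> h) a0"
    if "0 \<le> \<epsilon>" "\<epsilon> \<le> \<epsilon>0" "y \<in> parameter_set" "h > 0" "Cgeo * \<epsilon> / \<gamma> h \<in> {0..<1}" for \<epsilon> y h
    unfolding \<gamma>
  proof (rule perturbationsI)
    show "bilinear_form_on X X (a \<epsilon> y)" "bounded_form_on N X X (a \<epsilon> y)"
      unfolding a_T using bounded_operators_bounded_bilinear[OF N operators] that by auto
  qed (use that infsup_pos[of h] diff_le[of \<epsilon> y h] in \<open>auto simp: \<gamma>\<close>)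
  have small: "Cgeo * \<epsilon> / g \<in> {0..<1}" if "0 \<le> \<epsilon>" "g > 0" "\<epsilon> < g / Cgeo" for \<epsilon> g
    using that \<open>Cgeo > 0\<close> by (simp add: field_simps)
  \<comment> \<open>The bound \<open>\<gamma>low\<close> makes the family bounded below and
    \<open>h0 > 0\<close> makes the index set nonempty, so the infimum is a genuine one.\<close>
  have uniform: "(INF h\<in>{0<..h0}. \<gamma> h) \<ge> \<gamma>low \<and> (\<forall>h. 0 < h \<and> h \<le> h0 \<longrightarrow> (INF h\<in>{0<..h0}. \<gamma> h) \<le> \<gamma> h)"
    if "h0 > 0" "\<And>h. 0 < h \<Longrightarrow> h \<le> h0 \<Longrightarrow> \<gamma>low \<le> \<gamma> h" for h0 \<gamma>low
  proof -
    have "bdd_below (\<gamma> ` {0<..h0})" using that(2) by (intro bdd_belowI2[of _ \<gamma>low]) auto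
    then show ?thesis using that by (auto intro!: cINF_greatest cINF_lower)
  qed
  \<comment> \<open>Here \<open>g\<close> stands for the infimum of \<open>\<gamma>\<close>; only
    \<open>0 < g\<close> and \<open>g \<le> \<gamma> h\<close> enter. If the parameter for
    \<open>g\<close> lies in \<open>{0..<1}\<close>, so does the smaller nonnegative one for
    \<open>\<gamma> h\<close>, and \<open>pert\<close> applies.\<close>
  have second: "Cgeo * \<epsilon> / g \<ge> Cgeo * \<epsilon> / \<gamma> h \<and>
      (Cgeo * \<epsilon> / g \<in> {0..<1} \<longrightarrow>
         a \<epsilon> y \<in> perturbations X N (Xh h) (Yh h) (Cgeo * \<epsilon> / \<gamma> h) a0 \<and>
         perturbations X N (Xh h) (Yh h) (Cgeo * \<epsilon> / \<gamma> h) a0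
           \<subseteq> perturbations X N (Xh h) (Yh h) (Cgeo * \<epsilon> / g) a0)"
    if "0 \<le> \<epsilon>" "\<epsilon> \<le> \<epsilon>0" "y \<in> parameter_set" "h > 0" "g > 0" "g \<le> \<gamma> h" for \<epsilon> y h g
  proof -
    have le: "Cgeo * \<epsilon> / \<gamma> h \<le> Cgeo * \<epsilon> / g"
      using that \<open>Cgeo > 0\<close> by (intro divide_left_mono) auto
    moreover have "0 \<le> Cgeo * \<epsilon> / \<gamma> h" using that \<open>Cgeo > 0\<close> by simp
    ultimately show ?thesis
      using pert[of \<epsilon> y h] that perturbations_mono[OF N le] by auto
  qed
  show ?thesis
  proof (intro conjI allI impI, goal_cases)
    case (1 \<epsilon> y h)
    then show ?case using diff_le by blast
  next
    case (2 \<epsilon> y h)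
    then show ?case using pert by blast
  next
    case (3 \<epsilon> y h)
    then show ?case using small infsup_pos by blast
  next
    case (4 h0 \<gamma>low M)
    \<comment> \<open>The lower bound on the minimum in (S) is read off at its entry
      \<open>\<gamma> h\<close>.\<close>
    then have "h0 > 0" "\<gamma>low > 0" "\<And>h. 0 < h \<Longrightarrow> h \<le> h0 \<Longrightarrow> \<gamma>low \<le> \<gamma> h" by auto
    with uniform[of h0 \<gamma>low] have "(INF h\<in>{0<..h0}. \<gamma> h) > 0"
      "\<And>h. 0 < h \<Longrightarrow> h \<le> h0 \<Longrightarrow> (INF h\<in>{0<..h0}. \<gamma> h) \<le> \<gamma> h" by auto
    then show ?case
      unfolding Let_def using second small by blast
  qed
qed

end
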